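(* For all integers $n\geq 2$ and $k\geq 2$, there exists an $n$-valued map $f:T^k\to D_n(T^k)$ that is not homotopic to any affine $n$-valued map $T^k\to D_n(T^k)$.
   Context: $T^k=S^1\times\cdots\times S^1$ ($k$ factors) is the $k$-torus, with universal covering $p:\mathbb{R}^k\to T^k$, $p(t_1,\ldots,t_k)=(e^{2\pi i t_1},\ldots,e^{2\pi i t_k})$. $D_n(T^k)$ is the unordered configuration space of sets of $n$ distinct points of $T^k$, topologised as the quotient of $F_n(T^k)=\{(x_1,\ldots,x_n)\in (T^k)^n\mid x_i\neq x_j \text{ if } i\neq j\}$ by the permutation action of the symmetric group $\Sigma_n$. An $n$-valued map of $T^k$ is a continuous map $f:T^k\to D_n(T^k)$; two $n$-valued maps are homotopic if they are homotopic as continuous maps $T^k\to D_n(T^k)$. An $n$-valued map $f$ is called affine if there are matrices $A_1,\ldots,A_n\in\mathbb{R}^{k\times k}$ and vectors $\bar a_1,\ldots,\bar a_n\in\mathbb{R}^k$ such that $f(p(\bar t))=\{p(A_1\bar t+\bar a_1),\ldots,p(A_n\bar t+\bar a_n)\}$ for all $\bar t\in\mathbb{R}^k$. *)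

theory Defs
  imports "HOL-Analysis.Analysis"
begin

text \<open>The \<open>n\<close>-tuples of pairwise distinct points; tuples are extensional functions on \<open>{..<n}\<close>.\<close>

definition ordered_config :: "nat \<Rightarrow> 'a topology \<Rightarrow> (nat \<Rightarrow> 'a) topology" where
  "ordered_config n X = subtopology (product_topology (\<lambda>_. X) {..<n}) {x. inj_on x {..<n}}"

definition unordered_config :: "nat \<Rightarrow> 'a topology \<Rightarrow> 'a set topology" where
  "unordered_config n X = topology (\<lambda>U.
     U \<subseteq> (\<lambda>x. x ` {..<n}) ` topspace (ordered_config n X) \<and>
     openin (ordered_config n X) {x \<in> topspace (ordered_config n X). x ` {..<n} \<in> U})"

text \<open>An orbit of the symmetric group on ordered configurations is represented by the common set
  of values of its members. The lemmas below confirm that the topology is the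
  quotient topology, that the fibres are exactly the orbits, and that the points are exactly the
  \<open>n\<close>-element subsets.\<close>

lemma openin_unordered_config:
  "openin (unordered_config n X) U \<longleftrightarrow>
     U \<subseteq> (\<lambda>x. x ` {..<n}) ` topspace (ordered_config n X) \<and>
     openin (ordered_config n X) {x \<in> topspace (ordered_config n X). x ` {..<n} \<in> U}"
proof -
  let ?F = "ordered_config n X"
  let ?q = "\<lambda>x. x ` {..<n}"
  let ?P = "\<lambda>U. U \<subseteq> ?q ` topspace ?F \<and> openin ?F {x \<in> topspace ?F. ?q x \<in> U}"
  have "istopology ?P"
    unfolding istopology_def
  proof (intro conjI allI impI)
    fix S T assume S: "?P S" and T: "?P T"
    then show "S \<inter> T \<subseteq> ?q ` topspace ?F" by blast
    have "{x \<in> topspace ?F. ?q x \<in> S \<inter> T}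
        = {x \<in> topspace ?F. ?q x \<in> S} \<inter> {x \<in> topspace ?F. ?q x \<in> T}" by blast
    then show "openin ?F {x \<in> topspace ?F. ?q x \<in> S \<inter> T}"
      using S T by (simp add: openin_Int)
  next
    fix K assume K: "\<forall>S\<in>K. ?P S"
    then show "\<Union>K \<subseteq> ?q ` topspace ?F" by blast
    have "{x \<in> topspace ?F. ?q x \<in> \<Union>K} = (\<Union>S\<in>K. {x \<in> topspace ?F. ?q x \<in> S})" by blast
    then show "openin ?F {x \<in> topspace ?F. ?q x \<in> \<Union>K}"
      using K by (simp only:) (rule openin_Union, blast)
  qed
  then show ?thesis
    unfolding unordered_config_def by (simp add: topology_inverse')
qed

lemma topspace_unordered_config_image:
  "topspace (unordered_config n X) = (\<lambda>x. x ` {..<n}) ` topspace (ordered_config n X)"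
proof
  show "topspace (unordered_config n X) \<subseteq> (\<lambda>x. x ` {..<n}) ` topspace (ordered_config n X)"
    using openin_topspace openin_unordered_config by blast
  have *: "{x \<in> topspace (ordered_config n X).
          x ` {..<n} \<in> (\<lambda>x. x ` {..<n}) ` topspace (ordered_config n X)}
      = topspace (ordered_config n X)" by blast
  show "(\<lambda>x. x ` {..<n}) ` topspace (ordered_config n X) \<subseteq> topspace (unordered_config n X)"
    by (rule openin_subset) (simp add: openin_unordered_config *)
qed

lemma quotient_map_unordered_config:
  "quotient_map (ordered_config n X) (unordered_config n X) (\<lambda>x. x ` {..<n})"
  by (auto simp: quotient_map_def topspace_unordered_config_image openin_unordered_config)

lemma topspace_ordered_config:
  "topspace (ordered_config n X) = {x \<in> {..<n} \<rightarrow>\<^sub>E topspace X. inj_on x {..<n}}"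
  by (auto simp: ordered_config_def)

lemma topspace_unordered_config:
  "topspace (unordered_config n X) = {S. S \<subseteq> topspace X \<and> finite S \<and> card S = n}"
proof (intro equalityI subsetI)
  fix S assume "S \<in> topspace (unordered_config n X)"
  then show "S \<in> {S. S \<subseteq> topspace X \<and> finite S \<and> card S = n}"
    by (auto simp: topspace_unordered_config_image topspace_ordered_config card_image PiE_iff)
next
  fix S assume "S \<in> {S. S \<subseteq> topspace X \<and> finite S \<and> card S = n}"
  then have S: "S \<subseteq> topspace X" "finite S" "card S = n" by auto
  obtain h where h: "bij_betw h {..<n} S"
    using ex_bij_betw_nat_finite[OF S(2)] S(3) by (auto simp: atLeast0LessThan)
  have "restrict h {..<n} \<in> topspace (ordered_config n X)"
    using h S(1) by (auto simp: topspace_ordered_config bij_betw_def inj_on_def)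
  moreover have "restrict h {..<n} ` {..<n} = S"
    using h by (auto simp: bij_betw_def)
  ultimately show "S \<in> topspace (unordered_config n X)"
    unfolding topspace_unordered_config_image by blast
qed

lemma ordered_config_fibres:
  assumes "x \<in> topspace (ordered_config n X)" "y \<in> topspace (ordered_config n X)"
  shows "x ` {..<n} = y ` {..<n} \<longleftrightarrow> (\<exists>\<sigma>. \<sigma> permutes {..<n} \<and> (\<forall>i<n. y i = x (\<sigma> i)))"
proof
  assume eq: "x ` {..<n} = y ` {..<n}"
  have ix: "inj_on x {..<n}" and iy: "inj_on y {..<n}"
    using assms by (auto simp: topspace_ordered_config)
  let ?g = "\<lambda>i. the_inv_into {..<n} x (y i)"
  have "bij_betw (the_inv_into {..<n} x \<circ> y) {..<n} {..<n}"
    by (rule bij_betw_trans[of y _ "y ` {..<n}"])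
       (use ix iy eq bij_betw_the_inv_into[of x "{..<n}" "x ` {..<n}"] in \<open>auto simp: bij_betw_def\<close>)
  then have b: "bij_betw ?g {..<n} {..<n}" by (simp add: o_def)
  define \<sigma> where "\<sigma> = (\<lambda>i. if i \<in> {..<n} then ?g i else i)"
  have "bij_betw \<sigma> {..<n} {..<n}"
    using b by (rule bij_betw_cong[THEN iffD1, rotated]) (simp add: \<sigma>_def)
  then have "\<sigma> permutes {..<n}"
    by (rule bij_imp_permutes) (simp add: \<sigma>_def)
  moreover have "\<forall>i<n. y i = x (\<sigma> i)"
    using eq ix by (auto simp: \<sigma>_def f_the_inv_into_f)
  ultimately show "\<exists>\<sigma>. \<sigma> permutes {..<n} \<and> (\<forall>i<n. y i = x (\<sigma> i))" by blast
next
  assume "\<exists>\<sigma>. \<sigma> permutes {..<n} \<and> (\<forall>i<n. y i = x (\<sigma> i))"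
  then obtain \<sigma> where s: "\<sigma> permutes {..<n}" "\<forall>i<n. y i = x (\<sigma> i)" by blast
  have "y ` {..<n} = x ` \<sigma> ` {..<n}" using s(2) by (auto simp: image_image)
  then show "x ` {..<n} = y ` {..<n}" using permutes_image[OF s(1)] by simp
qed

definition torus :: "(complex ^ 'k) topology" where
  "torus = top_of_set {z. \<forall>i. z $ i \<in> sphere 0 1}"

definition torus_cover :: "real ^ 'k \<Rightarrow> complex ^ 'k" where
  "torus_cover t = (\<chi> i. exp (2 * complex_of_real pi * \<i> * complex_of_real (t $ i)))"

definition n_valued_map :: "nat \<Rightarrow> (complex ^ 'k \<Rightarrow> (complex ^ 'k) set) \<Rightarrow> bool" where
  "n_valued_map n f \<longleftrightarrow> continuous_map torus (unordered_config n torus) f"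

definition affine_n_valued_map :: "nat \<Rightarrow> (complex ^ 'k \<Rightarrow> (complex ^ 'k) set) \<Rightarrow> bool" where
  "affine_n_valued_map n f \<longleftrightarrow> n_valued_map n f \<and>
     (\<exists>(A :: nat \<Rightarrow> real ^ 'k ^ 'k) (a :: nat \<Rightarrow> real ^ 'k).
        \<forall>t. f (torus_cover t) = (\<lambda>i. torus_cover (A i *v t + a i)) ` {..<n})"

end

theory Submission
  imports Defs
begin

text \<open>
  The map that is not homotopic to an affine one takes \<open>z\<close> to \<open>n - 1\<close> constant points, one of which is the neutral
  element, together with one moving point. The moving point keeps all coordinates of \<open>z\<close> except two,
  \<open>i\<close> and \<open>j\<close>; there it runs, as \<open>z $ i\<close> runs around its circle, around a small circle about the neutral
  element. Forgetting that the neutral element must be avoided, the small circle can be contracted; the point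
  is that it cannot be contracted in the configuration space.

  Suppose a homotopy leads to an affine map \<open>g\<close>. By compactness the configurations along the
  homotopy have uniformly separated points and vary uniformly continuously
  (\<open>torus_cover_preimages_uniform\<close>), so single points of them can be followed in the universal cover, with bounded
  displacement (\<open>homotopy_section_lift\<close>). Following the moving point and the neutral element, and subtracting,
  gives a homotopy of maps into \<open>\<real>\<^sup>k\<close> without zeros. It starts at a tube \<open>S\<^sup>1 \<times> \<real>\<^sup>k\<^sup>-\<^sup>2\<close> around a linear subspace. Its
  final map comes from two branches of \<open>g\<close> (\<open>affine_section\<close>), hence is affine in the linear coordinates and the angle;
  since it is periodic in the angle and at bounded distance from the tube, it must collapse the tube to a
  translate of its axis. So zero, which is on the axis of the tube, could be avoided while the tube is squeezed
  by a bounded motion. Brouwer's fixed point theorem excludes this (\<open>tube_homotopy_has_zero\<close>).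
\<close>

section \<open>Separated families and their sections\<close>

definition separated_over :: "real \<Rightarrow> 'x set \<Rightarrow> ('x \<Rightarrow> 'v::metric_space set) \<Rightarrow> bool" where
  "separated_over \<eta> X G \<longleftrightarrow> (\<forall>x\<in>X. \<forall>v\<in>G x. \<forall>w\<in>G x. dist v w < \<eta> \<longrightarrow> v = w)"

text \<open>Since \<open>x\<close> and \<open>y\<close> may be exchanged, this bounds the Hausdorff distance between nearby fibres.
  The one-sided form is what a lift needs: a chosen point can be followed.\<close>

definition uniformly_lower_hemicontinuous_on :: "'x::metric_space set \<Rightarrow> ('x \<Rightarrow> 'v::metric_space set) \<Rightarrow> bool" where
  "uniformly_lower_hemicontinuous_on X G \<longleftrightarrow>
     (\<forall>\<epsilon>>0. \<exists>\<delta>>0. \<forall>x\<in>X. \<forall>y\<in>X. dist x y < \<delta> \<longrightarrow> (\<forall>v\<in>G x. \<exists>w\<in>G y. dist v w < \<epsilon>))"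

text \<open>The distance between the two sections is a continuous function that omits the interval
  between \<open>0\<close> and \<open>\<eta>\<close>, so on a connected set it cannot leave the value \<open>0\<close>. This plays the part of
  the uniqueness of lifts in a covering space.\<close>

lemma sections_agree:
  fixes s s' :: "'x::topological_space \<Rightarrow> 'v::real_normed_vector"
  assumes conn: "connected X" and "\<eta> > 0" and sep: "separated_over \<eta> X G"
    and cont: "continuous_on X s" "continuous_on X s'"
    and mem: "\<And>x. x \<in> X \<Longrightarrow> s x \<in> G x" "\<And>x. x \<in> X \<Longrightarrow> s' x \<in> G x"
    and x0: "x0 \<in> X" "s x0 = s' x0" and x: "x \<in> X"
  shows "s x = s' x"
proof (rule ccontr)
  assume ne: "s x \<noteq> s' x"
  let ?D = "\<lambda>x. dist (s x) (s' x)"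
  have "connected (?D ` X)"
    by (intro connected_continuous_image continuous_intros cont conn)
  moreover have "?D x \<ge> \<eta>"
    using sep mem[OF x] x ne by (force simp: separated_over_def)
  moreover have "0 \<in> ?D ` X" using x0 by force
  ultimately have "\<eta>/2 \<in> ?D ` X"
    using connectedD_interval[of "?D ` X" 0 "?D x" "\<eta>/2"] x \<open>\<eta> > 0\<close> by auto
  then obtain y where y: "y \<in> X" "?D y = \<eta>/2" by auto
  then have "s y = s' y"
    using sep mem[OF y(1)] \<open>\<eta> > 0\<close> by (simp add: separated_over_def)
  with y \<open>\<eta> > 0\<close> show False by simp
qed

text \<open>Within \<open>\<eta>/2\<close> of a given point a fibre has at most one element. Hence the section that
  picks the element near \<open>c x\<close> has no freedom, and it must follow its fibre continuously.\<close>

lemma near_section_continuous: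
  fixes c s :: "'x::metric_space \<Rightarrow> 'v::metric_space"
  assumes sep: "separated_over \<eta> X G"
    and lhc: "\<And>x v \<epsilon>. \<lbrakk>x \<in> X; v \<in> G x; \<epsilon> > 0\<rbrakk> \<Longrightarrow>
                \<exists>\<delta>>0. \<forall>y\<in>X. dist y x < \<delta> \<longrightarrow> (\<exists>w\<in>G y. dist v w < \<epsilon>)"
    and c: "continuous_on X c"
    and s: "\<And>x. x \<in> X \<Longrightarrow> s x \<in> G x" and near: "\<And>x. x \<in> X \<Longrightarrow> dist (c x) (s x) < \<eta>/2"
  shows "continuous_on X s"
proof (rule continuous_onI)
  fix x and \<epsilon> :: real assume x: "x \<in> X" and "\<epsilon> > 0"
  define e where "e = min \<epsilon> ((\<eta>/2 - dist (c x) (s x)) / 2)"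
  have "e > 0" using near[OF x] \<open>\<epsilon> > 0\<close> by (simp add: e_def)
  obtain d1 where d1: "d1 > 0" "\<And>y. y \<in> X \<Longrightarrow> dist y x < d1 \<Longrightarrow> \<exists>w\<in>G y. dist (s x) w < e"
    using lhc[OF x s[OF x] \<open>e > 0\<close>] by blast
  obtain d2 where d2: "d2 > 0" "\<And>y. y \<in> X \<Longrightarrow> dist y x < d2 \<Longrightarrow> dist (c y) (c x) < e"
    using c x \<open>e > 0\<close> unfolding continuous_on_iff by metis
  have "dist (s y) (s x) \<le> \<epsilon>" if y: "y \<in> X" "dist y x < min d1 d2" for y
  proof -
    obtain w where w: "w \<in> G y" "dist (s x) w < e" using d1 y by auto
    have "dist (c y) (c x) < e" using d2 y by auto
    then have "dist (c y) w < \<eta>/2"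
      using w(2) dist_triangle[of "c y" w "c x"] dist_triangle[of "c x" w "s x"]
      by (simp add: e_def)
    then have "dist w (s y) < \<eta>"
      using near[OF y(1)] dist_triangle[of w "s y" "c y"] by (simp add: dist_commute)
    then have "w = s y" using sep y w s by (auto simp: separated_over_def)
    with w show ?thesis by (simp add: e_def dist_commute)
  qed
  then show "\<exists>d>0. \<forall>y\<in>X. dist y x < d \<longrightarrow> dist (s y) (s x) \<le> \<epsilon>"
    using d1(1) d2(1) by (intro exI[of _ "min d1 d2"]) auto
qed

text \<open>Time is cut into steps so short that no point of a fibre moves by \<open>\<eta>/2\<close> during one step; the
  section is then prolonged by taking the nearest point. Compared with a covering-space argument
  this yields the uniform bound \<open>M\<close> on the displacement, even though \<open>U\<close> need not be compact: it is
  the number of steps times \<open>\<eta>/2\<close>.\<close>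

lemma homotopy_section_lift:
  fixes G :: "real \<times> 'z::metric_space \<Rightarrow> 'v::metric_space set"
    and q :: "'u::metric_space \<Rightarrow> 'z"
  assumes "\<eta> > 0" and sep: "separated_over \<eta> ({0..1} \<times> Z) G"
    and unif: "uniformly_lower_hemicontinuous_on ({0..1} \<times> Z) G"
    and q: "continuous_on U q" "q ` U \<subseteq> Z"
    and \<phi>: "continuous_on U \<phi>" "\<And>u. u \<in> U \<Longrightarrow> \<phi> u \<in> G (0, q u)"
  obtains h M where "continuous_on ({0..1} \<times> U) h" "\<And>u. u \<in> U \<Longrightarrow> h (0, u) = \<phi> u"
    "\<And>t u. \<lbrakk>t \<in> {0..1}; u \<in> U\<rbrakk> \<Longrightarrow> h (t, u) \<in> G (t, q u)"
    "\<And>t u. \<lbrakk>t \<in> {0..1}; u \<in> U\<rbrakk> \<Longrightarrow> dist (h (t, u)) (\<phi> u) \<le> M"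
proof -
  obtain \<delta> where "\<delta> > 0" and \<delta>: "\<And>x y v. \<lbrakk>x \<in> {0..1} \<times> Z; y \<in> {0..1} \<times> Z; dist x y < \<delta>; v \<in> G x\<rbrakk>
      \<Longrightarrow> \<exists>w\<in>G y. dist v w < \<eta>/2"
    using unif \<open>\<eta> > 0\<close> unfolding uniformly_lower_hemicontinuous_on_def by (metis half_gt_zero)
  let ?P = "\<lambda>N T h. continuous_on ({0..T} \<times> U) h \<and> (\<forall>u\<in>U. h (0, u) = \<phi> u) \<and>
      (\<forall>t\<in>{0..T}. \<forall>u\<in>U. h (t, u) \<in> G (t, q u) \<and> dist (h (t, u)) (\<phi> u) \<le> real N * (\<eta>/2))"
  have main: "\<exists>h. ?P N T h" if "0 \<le> T" "T \<le> 1" "T \<le> real N * (\<delta>/2)" for N T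
    using that
  proof (induction N arbitrary: T)
    case 0
    then have "T = 0" by simp
    then show ?case
      using \<phi> by (intro exI[of _ "\<lambda>x. \<phi> (snd x)"])
        (auto intro!: continuous_on_compose2[OF \<phi>(1)] continuous_intros)
  next
    case (Suc N)
    define T0 where "T0 = max 0 (T - \<delta>/2)"
    have "0 \<le> real N * (\<delta>/2)" using \<open>\<delta> > 0\<close> by simp
    moreover have "T - \<delta>/2 \<le> real N * (\<delta>/2)" using Suc.prems by (simp add: algebra_simps)
    ultimately have "T0 \<le> real N * (\<delta>/2)" unfolding T0_def by (rule max.boundedI)
    then have T0: "0 \<le> T0" "T0 \<le> T" "T0 \<le> 1" "T - T0 < \<delta>" "T0 \<le> real N * (\<delta>/2)"
      using Suc.prems \<open>\<delta> > 0\<close> by (auto simp: T0_def)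
    obtain h where h: "?P N T0 h" using Suc.IH[OF T0(1,3,5)] by blast
    have "\<exists>w. w \<in> G (t, q u) \<and> dist (h (T0, u)) w < \<eta>/2" if "t \<in> {T0..T}" "u \<in> U" for t u
    proof -
      have "\<exists>w\<in>G (t, q u). dist (h (T0, u)) w < \<eta>/2"
        by (rule \<delta>[of "(T0, q u)"])
          (use that T0 q(2) h Suc.prems in \<open>auto simp: dist_Pair_Pair dist_real_def\<close>)
      then show ?thesis by blast
    qed
    then obtain k where k: "\<And>t u. \<lbrakk>t \<in> {T0..T}; u \<in> U\<rbrakk> \<Longrightarrow>
        k (t, u) \<in> G (t, q u) \<and> dist (h (T0, u)) (k (t, u)) < \<eta>/2"
      by (metis (no_types, lifting) case_prod_conv)
    \<comment> \<open>The old and the new piece match at their common time, because both lie in one fibre.\<close>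
    have kT0: "k (T0, u) = h (T0, u)" if "u \<in> U" for u
    proof -
      have "dist (h (T0, u)) (k (T0, u)) < \<eta>"
        using k[of T0 u] that T0 \<open>\<eta> > 0\<close> by simp
      moreover have "h (T0, u) \<in> G (T0, q u)" "k (T0, u) \<in> G (T0, q u)"
        using k[of T0 u] h that T0 by auto
      moreover have "(T0, q u) \<in> {0..1} \<times> Z" using T0 that q by auto
      ultimately show ?thesis using sep unfolding separated_over_def by metis
    qed
    have contk: "continuous_on ({T0..T} \<times> U) k"
    proof (rule near_section_continuous[where G = "\<lambda>x. G (fst x, q (snd x))" and \<eta> = \<eta>
          and c = "\<lambda>x. h (T0, snd x)"])
      show "separated_over \<eta> ({T0..T} \<times> U) (\<lambda>x. G (fst x, q (snd x)))"
        using sep q(2) T0 Suc.prems unfolding separated_over_def by force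
      show "continuous_on ({T0..T} \<times> U) (\<lambda>x. h (T0, snd x))"
        by (rule continuous_on_compose2[of "{0..T0} \<times> U" h])
          (use h T0 in \<open>auto intro!: continuous_intros\<close>)
      show "k x \<in> G (fst x, q (snd x))" "dist (h (T0, snd x)) (k x) < \<eta>/2" if "x \<in> {T0..T} \<times> U" for x
        using k[of "fst x" "snd x"] that by auto
    next
      fix x v and \<epsilon> :: real
      assume x: "x \<in> {T0..T} \<times> U" and v: "v \<in> G (fst x, q (snd x))" and "\<epsilon> > 0"
      obtain d where d: "d > 0" "\<And>x y v. \<lbrakk>x \<in> {0..1} \<times> Z; y \<in> {0..1} \<times> Z; dist x y < d; v \<in> G x\<rbrakk>
          \<Longrightarrow> \<exists>w\<in>G y. dist v w < \<epsilon>"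
        using unif \<open>\<epsilon> > 0\<close> unfolding uniformly_lower_hemicontinuous_on_def by metis
      have "continuous_on ({T0..T} \<times> U) (\<lambda>y. (fst y, q (snd y)))"
        by (auto intro!: continuous_on_compose2[OF q(1)] continuous_intros)
      then obtain \<delta>' where \<delta>': "\<delta>' > 0" "\<And>y. y \<in> {T0..T} \<times> U \<Longrightarrow> dist y x < \<delta>' \<Longrightarrow>
          dist (fst y, q (snd y)) (fst x, q (snd x)) < d"
        using x d(1) unfolding continuous_on_iff by metis
      have "\<exists>w\<in>G (fst y, q (snd y)). dist v w < \<epsilon>" if y: "y \<in> {T0..T} \<times> U" "dist y x < \<delta>'" for y
        by (rule d(2)[OF _ _ _ v])
          (use \<delta>'(2)[OF y] x y q(2) T0 Suc.prems in \<open>auto simp: dist_commute\<close>)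
      with \<delta>'(1) show "\<exists>\<delta>>0. \<forall>y\<in>{T0..T} \<times> U. dist y x < \<delta> \<longrightarrow>
          (\<exists>w\<in>G (fst y, q (snd y)). dist v w < \<epsilon>)" by blast
    qed
    let ?g = "\<lambda>x. if fst x \<le> T0 then h x else k x"
    have "continuous_on ({0..T0} \<times> U \<union> {T0..T} \<times> U) ?g"
    proof (rule continuous_on_Un_local)
      let ?W = "{0..T0} \<times> U \<union> {T0..T} \<times> U"
      have "{0..T0} \<times> U = ?W \<inter> (fst -` {0..T0})" using T0 by auto
      then show "closedin (top_of_set ?W) ({0..T0} \<times> U)"
        by (metis closedin_closed closed_vimage_fst closed_atLeastAtMost)
      have "{T0..T} \<times> U = ?W \<inter> (fst -` {T0..T})" using T0 by auto
      then show "closedin (top_of_set ?W) ({T0..T} \<times> U)"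
        by (metis closedin_closed closed_vimage_fst closed_atLeastAtMost)
      show "continuous_on ({0..T0} \<times> U) ?g"
        using h by (subst continuous_on_cong[OF refl, of _ _ h]) auto
      have "continuous_on ({T0..T} \<times> U) ?g \<longleftrightarrow> continuous_on ({T0..T} \<times> U) k"
      proof (rule continuous_on_cong[OF refl])
        fix x assume x: "x \<in> {T0..T} \<times> U"
        then have "fst x \<le> T0 \<Longrightarrow> x = (T0, snd x)" by (cases x) auto
        moreover have "h (T0, snd x) = k (T0, snd x)" using kT0 x by auto
        ultimately show "?g x = k x" by (metis (full_types))
      qed
      with contk show "continuous_on ({T0..T} \<times> U) ?g" by simp
    qed
    moreover have "{0..T0} \<times> U \<union> {T0..T} \<times> U = {0..T} \<times> U" using T0 by auto
    moreover have "?g (t, u) \<in> G (t, q u) \<and> dist (?g (t, u)) (\<phi> u) \<le> real (Suc N) * (\<eta>/2)"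
      if tu: "t \<in> {0..T}" "u \<in> U" for t u
    proof (cases "t \<le> T0")
      case True
      then have "h (t, u) \<in> G (t, q u)" "dist (h (t, u)) (\<phi> u) \<le> real N * (\<eta>/2)"
        using h tu by auto
      with True \<open>\<eta> > 0\<close> show ?thesis by (simp add: algebra_simps)
    next
      case False
      then have "k (t, u) \<in> G (t, q u)" "dist (h (T0, u)) (k (t, u)) < \<eta>/2"
        using k[of t u] tu by auto
      moreover have "dist (h (T0, u)) (\<phi> u) \<le> real N * (\<eta>/2)" using h tu T0 by auto
      ultimately show ?thesis
        using False dist_triangle[of "k (t, u)" "\<phi> u" "h (T0, u)"]
        by (simp add: algebra_simps dist_commute)
    qed
    ultimately show ?case using h T0 by (intro exI[of _ ?g]) auto
  qed
  obtain N :: nat where "1 / (\<delta>/2) < real N" using reals_Archimedean2 by blast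
  then have "1 \<le> real N * (\<delta>/2)" using \<open>\<delta> > 0\<close> by (simp add: field_simps)
  then obtain h where "?P N 1 h" using main[of 1 N] by auto
  then show thesis by (intro that[of h "real N * (\<eta>/2)"]) auto
qed

section \<open>Configuration-valued maps on compact sets\<close>

lemma openin_unordered_config_meets:
  assumes "openin X W"
  shows "openin (unordered_config n X) {S \<in> topspace (unordered_config n X). S \<inter> W \<noteq> {}}"
proof -
  let ?F = "ordered_config n X"
  let ?V = "{S \<in> topspace (unordered_config n X). S \<inter> W \<noteq> {}}"
  have "openin ?F {x \<in> topspace ?F. x i \<in> W}" if "i < n" for i
  proof (rule openin_continuous_map_preimage[OF _ assms])
    show "continuous_map ?F X (\<lambda>x. x i)"
      unfolding ordered_config_def
      using that by (intro continuous_map_from_subtopology continuous_map_product_projection) simp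
  qed
  then have "openin ?F (\<Union>i\<in>{..<n}. {x \<in> topspace ?F. x i \<in> W})" by blast
  moreover have "{x \<in> topspace ?F. x ` {..<n} \<in> ?V} = (\<Union>i\<in>{..<n}. {x \<in> topspace ?F. x i \<in> W})"
    unfolding topspace_unordered_config_image by blast
  ultimately show ?thesis
    unfolding openin_unordered_config topspace_unordered_config_image by auto
qed

text \<open>The balls around the points of \<open>S\<close> are disjoint and there are as many of them as points
  of \<open>S'\<close>. So, by counting, no ball contains two points of \<open>S'\<close> and no point of \<open>S'\<close> is outside the balls.\<close>

lemma config_matching:
  fixes S S' :: "'a::metric_space set"
  assumes fin: "finite S" "finite S'" and card: "card S' = card S"
    and sep: "\<And>s s'. \<lbrakk>s \<in> S; s' \<in> S; s \<noteq> s'\<rbrakk> \<Longrightarrow> 2 * \<rho> \<le> dist s s'"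
    and meets: "\<And>s. s \<in> S \<Longrightarrow> S' \<inter> ball s \<rho> \<noteq> {}"
  obtains c where "c ` S = S'" "\<And>s. s \<in> S \<Longrightarrow> dist s (c s) < \<rho>"
proof -
  have "\<forall>s\<in>S. \<exists>z. z \<in> S' \<and> dist s z < \<rho>" using meets by fastforce
  then obtain c where c: "\<And>s. s \<in> S \<Longrightarrow> c s \<in> S' \<and> dist s (c s) < \<rho>"
    by metis
  have "inj_on c S"
  proof (rule inj_onI, rule ccontr)
    fix s s' assume s: "s \<in> S" "s' \<in> S" "c s = c s'" "s \<noteq> s'"
    have "dist s (c s) < \<rho>" using c[OF s(1)] by blast
    moreover have "dist s' (c s) < \<rho>" using c[OF s(2)] unfolding s(3) by blast
    ultimately show False using sep[OF s(1,2,4)] dist_triangle2[of s s' "c s"] by linarith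
  qed
  then have "c ` S = S'"
    using c card fin by (intro card_subset_eq) (auto simp: card_image)
  with c that show thesis by blast
qed

text \<open>On the open set where \<open>H y\<close> meets a small ball around each point of \<open>H x\<close>, the configurations
  \<open>H y\<close> are matched with \<open>H x\<close>, and hence with each other. The constant \<open>\<mu>\<close> does not depend on
  \<open>\<epsilon>\<close>, so that separation and closeness are available on a common neighbourhood.\<close>

lemma config_map_locally_uniform:
  fixes H :: "'x::metric_space \<Rightarrow> 'a::metric_space set"
  assumes H: "continuous_map (top_of_set K) (unordered_config n (top_of_set T)) H"
    and x: "x \<in> K"
  shows "\<exists>\<mu>>0. \<forall>\<epsilon>>0. \<exists>V. open V \<and> x \<in> V \<and>
           separated_over \<mu> (V \<inter> K) H \<and>
           (\<forall>y\<in>V \<inter> K. \<forall>y'\<in>V \<inter> K. \<forall>z\<in>H y. \<exists>w\<in>H y'. dist z w < \<epsilon>)"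
proof -
  have conf: "H y \<subseteq> T \<and> finite (H y) \<and> card (H y) = n" if "y \<in> K" for y
    using continuous_map_image_subset_topspace[OF H] that
    by (auto simp: topspace_unordered_config)
  let ?S = "H x"
  have "\<exists>m>0. \<forall>s\<in>?S. \<forall>s'\<in>?S. s \<noteq> s' \<longrightarrow> m \<le> dist s s'"
  proof -
    let ?A = "insert 1 ((\<lambda>(s, s'). dist s s') ` {p \<in> ?S \<times> ?S. fst p \<noteq> snd p})"
    have fin: "finite ?A" using conf[OF x] by auto
    have "Min ?A > 0" using fin by (subst Min_gr_iff) auto
    moreover have "Min ?A \<le> dist s s'" if "s \<in> ?S" "s' \<in> ?S" "s \<noteq> s'" for s s'
      using fin that by (intro Min_le) auto
    ultimately show ?thesis by blast
  qed
  then obtain m where m: "m > 0" "\<And>s s'. \<lbrakk>s \<in> ?S; s' \<in> ?S; s \<noteq> s'\<rbrakk> \<Longrightarrow> m \<le> dist s s'" by blast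
  have "\<exists>V. open V \<and> x \<in> V \<and> separated_over (m/2) (V \<inter> K) H \<and>
           (\<forall>y\<in>V \<inter> K. \<forall>y'\<in>V \<inter> K. \<forall>z\<in>H y. \<exists>w\<in>H y'. dist z w < \<epsilon>)" if "\<epsilon> > 0" for \<epsilon>
  proof -
    define \<rho> where "\<rho> = min (m/4) (\<epsilon>/2)"
    have \<rho>: "\<rho> > 0" "4 * \<rho> \<le> m" "2 * \<rho> \<le> \<epsilon>" using m(1) \<open>\<epsilon> > 0\<close> by (auto simp: \<rho>_def)
    have opn: "openin (top_of_set K) {y \<in> K. H y \<inter> ball s \<rho> \<noteq> {}}" for s
    proof -
      have "openin (top_of_set T) (T \<inter> ball s \<rho>)" by (simp add: openin_open_Int)
      from openin_continuous_map_preimage[OF H openin_unordered_config_meets[OF this]]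
      have "openin (top_of_set K) {y \<in> K. H y \<in> {S \<in> topspace (unordered_config n (top_of_set T)).
              S \<inter> (T \<inter> ball s \<rho>) \<noteq> {}}}" by simp
      moreover have "{y \<in> K. H y \<in> {S \<in> topspace (unordered_config n (top_of_set T)).
              S \<inter> (T \<inter> ball s \<rho>) \<noteq> {}}} = {y \<in> K. H y \<inter> ball s \<rho> \<noteq> {}}"
      proof (intro Collect_cong conj_cong refl)
        fix y assume "y \<in> K"
        then have "H y \<inter> (T \<inter> ball s \<rho>) = H y \<inter> ball s \<rho>" "H y \<in> topspace (unordered_config n (top_of_set T))"
          using conf[of y] by (auto simp: topspace_unordered_config)
        then show "H y \<in> {S \<in> topspace (unordered_config n (top_of_set T)). S \<inter> (T \<inter> ball s \<rho>) \<noteq> {}}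
            \<longleftrightarrow> H y \<inter> ball s \<rho> \<noteq> {}" by simp
      qed
      ultimately show ?thesis by simp
    qed
    define W where "W = (\<Inter>s\<in>?S. {y \<in> K. H y \<inter> ball s \<rho> \<noteq> {}}) \<inter> topspace (top_of_set K)"
    have "openin (top_of_set K) W"
      unfolding W_def using conf[OF x] opn by (intro openin_INT) blast+
    then obtain V where V: "open V" "W = K \<inter> V" by (metis openin_open)
    have "s \<in> H x \<inter> ball s \<rho>" if "s \<in> ?S" for s using that \<rho>(1) by simp
    then have "x \<in> W" unfolding W_def using x by auto
    then have "x \<in> V" using V(2) by blast
    have match: "\<exists>c. c ` ?S = H y \<and> (\<forall>s\<in>?S. dist s (c s) < \<rho>)" if y: "y \<in> V \<inter> K" for y
    proof -
      have "\<And>s. s \<in> ?S \<Longrightarrow> H y \<inter> ball s \<rho> \<noteq> {}" using V(2) y unfolding W_def by blast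
      moreover have "2 * \<rho> \<le> dist s s'" if "s \<in> ?S" "s' \<in> ?S" "s \<noteq> s'" for s s'
        using m(2)[OF that] \<rho> by simp
      ultimately show ?thesis
        using config_matching[of ?S "H y" \<rho>] conf[OF x] conf[of y] y by (metis IntD2)
    qed
    have "separated_over (m/2) (V \<inter> K) H"
      unfolding separated_over_def
    proof (intro ballI impI, rule ccontr)
      fix y z z' assume y: "y \<in> V \<inter> K" and z: "z \<in> H y" "z' \<in> H y" "dist z z' < m/2" "z \<noteq> z'"
      obtain c where c: "c ` ?S = H y" "\<And>s. s \<in> ?S \<Longrightarrow> dist s (c s) < \<rho>" using match[OF y] by blast
      obtain s s' where s: "s \<in> ?S" "s' \<in> ?S" "z = c s" "z' = c s'" using z(1,2) c(1) by blast
      have "m \<le> dist s s'" using m(2) s z(4) by blast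
      also have "\<dots> \<le> dist s z + dist z z' + dist z' s'"
        using dist_triangle[of s s' z] dist_triangle[of z s' z'] by simp
      also have "\<dots> < \<rho> + m/2 + \<rho>"
        using c(2)[OF s(1)] c(2)[OF s(2)] s z(3) by (simp add: dist_commute)
      finally show False using \<rho> by simp
    qed
    moreover have "\<exists>w\<in>H y'. dist z w < \<epsilon>"
      if y: "y \<in> V \<inter> K" "y' \<in> V \<inter> K" and z: "z \<in> H y" for y y' z
    proof -
      obtain c where c: "c ` ?S = H y" "\<And>s. s \<in> ?S \<Longrightarrow> dist s (c s) < \<rho>" using match[OF y(1)] by blast
      obtain c' where c': "c' ` ?S = H y'" "\<And>s. s \<in> ?S \<Longrightarrow> dist s (c' s) < \<rho>" using match[OF y(2)] by blast
      obtain s where s: "s \<in> ?S" "z = c s" using z c(1) by blast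
      have "dist z (c' s) < \<epsilon>"
        using c(2)[OF s(1)] c'(2)[OF s(1)] s dist_triangle3[of z "c' s" s] \<rho>(3) by simp
      then show ?thesis using c' s by blast
    qed
    ultimately show ?thesis using V(1) \<open>x \<in> V\<close> by blast
  qed
  then show ?thesis using m(1) by (intro exI[of _ "m/2"]) auto
qed

lemma config_map_uniform:
  fixes H :: "'x::metric_space \<Rightarrow> 'a::metric_space set"
  assumes H: "continuous_map (top_of_set K) (unordered_config n (top_of_set T)) H"
    and K: "compact K"
  shows "\<exists>\<eta>>0. separated_over \<eta> K H" and "uniformly_lower_hemicontinuous_on K H"
proof -
  let ?close = "\<lambda>\<epsilon> V. \<forall>y\<in>V \<inter> K. \<forall>y'\<in>V \<inter> K. \<forall>z\<in>H y. \<exists>w\<in>H y'. dist z w < \<epsilon>"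
  obtain \<mu> where \<mu>: "\<And>x. x \<in> K \<Longrightarrow> \<mu> x > 0"
    "\<And>x \<epsilon>. \<lbrakk>x \<in> K; \<epsilon> > 0\<rbrakk> \<Longrightarrow>
       \<exists>V. open V \<and> x \<in> V \<and> separated_over (\<mu> x) (V \<inter> K) H \<and> ?close \<epsilon> V"
    using config_map_locally_uniform[OF H] by metis
  obtain V where V: "\<And>x \<epsilon>. \<lbrakk>x \<in> K; \<epsilon> > 0\<rbrakk> \<Longrightarrow> open (V x \<epsilon>) \<and> x \<in> V x \<epsilon> \<and>
       separated_over (\<mu> x) (V x \<epsilon> \<inter> K) H \<and> ?close \<epsilon> (V x \<epsilon>)"
    using \<mu>(2) by metis
  show "\<exists>\<eta>>0. separated_over \<eta> K H"
  proof -
    obtain C where C: "C \<subseteq> K" "finite C" "K \<subseteq> (\<Union>x\<in>C. V x 1)"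
      by (rule compactE_image[OF K, of K "\<lambda>x. V x 1"]) (use V in auto)
    define \<eta> where "\<eta> = Min (insert 1 (\<mu> ` C))"
    have "\<eta> > 0" using C \<mu>(1) by (auto simp: \<eta>_def)
    moreover have "\<eta> \<le> \<mu> x" if "x \<in> C" for x using C that by (auto simp: \<eta>_def)
    moreover have "separated_over \<eta> K H"
      unfolding separated_over_def
    proof (intro ballI impI)
      fix y z w assume y: "y \<in> K" "z \<in> H y" "w \<in> H y" "dist z w < \<eta>"
      obtain x where x: "x \<in> C" "y \<in> V x 1" using C(3) y(1) by blast
      have "separated_over (\<mu> x) (V x 1 \<inter> K) H" using V[of x 1] C(1) x(1) by auto
      moreover have "dist z w < \<mu> x" using y(4) \<open>\<And>x. x \<in> C \<Longrightarrow> \<eta> \<le> \<mu> x\<close>[OF x(1)] by simp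
      ultimately show "z = w" using y x(2) unfolding separated_over_def by blast
    qed
    ultimately show ?thesis by blast
  qed
  show "uniformly_lower_hemicontinuous_on K H"
    unfolding uniformly_lower_hemicontinuous_on_def
  proof (intro allI impI)
    fix \<epsilon> :: real assume "\<epsilon> > 0"
    obtain \<delta> where \<delta>: "\<delta> > 0" "\<And>x. x \<in> K \<Longrightarrow> \<exists>W\<in>(\<lambda>x. V x \<epsilon>) ` K. ball x \<delta> \<subseteq> W"
      by (rule Heine_Borel_lemma[OF K, of "(\<lambda>x. V x \<epsilon>) ` K"]) (use V \<open>\<epsilon> > 0\<close> in auto)
    have "\<forall>z\<in>H x. \<exists>w\<in>H y. dist z w < \<epsilon>" if xy: "x \<in> K" "y \<in> K" "dist x y < \<delta>" for x y
    proof -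
      obtain x' where x': "x' \<in> K" "ball x \<delta> \<subseteq> V x' \<epsilon>" using \<delta>(2) xy by blast
      then have "x \<in> V x' \<epsilon> \<inter> K" "y \<in> V x' \<epsilon> \<inter> K" using xy \<delta>(1) by auto
      then show ?thesis using V[OF x'(1) \<open>\<epsilon> > 0\<close>] by blast
    qed
    then show "\<exists>\<delta>>0. \<forall>x\<in>K. \<forall>y\<in>K. dist x y < \<delta> \<longrightarrow> (\<forall>z\<in>H x. \<exists>w\<in>H y. dist z w < \<epsilon>)"
      using \<delta>(1) by blast
  qed
qed

section \<open>Preimages in the universal cover of the torus\<close>

lemma torus_cover_nth: "torus_cover t $ i = cis (2 * pi * t $ i)"
  by (simp add: torus_cover_def cis_conv_exp mult_ac)

lemma dist_cis_le: "dist (cis a) (cis b) \<le> \<bar>a - b\<bar>"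
proof -
  have "cis a - cis b = cis b * (cis (a - b) - 1)"
    by (simp add: cis_mult right_diff_distrib)
  then have "dist (cis a) (cis b) = 2 * \<bar>sin ((a - b) / 2)\<bar>"
    using dist_exp_i_1[of "a - b"] by (simp add: dist_norm norm_mult cis_conv_exp)
  also have "\<dots> \<le> \<bar>a - b\<bar>" using abs_sin_x_le_abs_x[of "(a - b)/2"] by simp
  finally show ?thesis .
qed

lemma torus_cover_lipschitz: "dist (torus_cover v) (torus_cover w) \<le> 2 * pi * dist v w"
proof -
  have "norm (torus_cover v - torus_cover w) \<le> norm ((2 * pi) *\<^sub>R (v - w))"
  proof -
    let ?y = "(2 * pi) *\<^sub>R (v - w)"
    have "norm ((torus_cover v - torus_cover w) $ i) \<le> norm (?y $ i)" for i
      using dist_cis_le[of "2 * pi * v $ i" "2 * pi * w $ i"]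
      by (simp add: torus_cover_nth dist_norm algebra_simps)
    then show ?thesis unfolding norm_vec_def by (intro L2_set_mono) auto
  qed
  then show ?thesis by (simp add: dist_norm)
qed

lemma cis_eq_iff_Ints: "cis (2 * pi * a) = cis (2 * pi * b) \<longleftrightarrow> a - b \<in> \<int>"
proof -
  have "cis (2 * pi * a) = cis (2 * pi * b) \<longleftrightarrow> (\<exists>m::int. 2 * pi * a = 2 * pi * b + 2 * pi * m)"
    by (simp add: complex_eq_iff conj_commute flip: sin_cos_eq_iff)
  also have "\<dots> \<longleftrightarrow> (\<exists>m::int. a - b = m)"
  proof -
    have "2 * pi * a = 2 * pi * b + 2 * pi * m \<longleftrightarrow> a - b = m" for m :: real
    proof -
      have "2 * pi * a = 2 * pi * b + 2 * pi * m \<longleftrightarrow> (2 * pi) * a = (2 * pi) * (b + m)"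
        by (simp add: algebra_simps)
      then show ?thesis by (simp only: mult_cancel_left) (auto simp: algebra_simps)
    qed
    then show ?thesis by simp
  qed
  finally show ?thesis by (auto simp: Ints_def)
qed

lemma torus_cover_eq_iff: "torus_cover v = torus_cover w \<longleftrightarrow> (\<forall>i. v $ i - w $ i \<in> \<int>)"
  by (simp add: vec_eq_iff torus_cover_nth cis_eq_iff_Ints)

text \<open>A uniform form of openness of the covering map: in each coordinate the angle of
  \<open>z $ i / cis (2 * pi * v $ i)\<close> is small, and adding it to \<open>v $ i\<close> gives the lift.\<close>

lemma torus_cover_uniformly_open:
  fixes \<epsilon> :: real
  assumes "\<epsilon> > 0"
  shows "\<exists>\<delta>>0. \<forall>(v :: real^'k::finite) z. z \<in> topspace torus \<longrightarrow> dist (torus_cover v) z < \<delta> \<longrightarrow>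
           (\<exists>w. torus_cover w = z \<and> dist v w < \<epsilon>)"
proof -
  define e where "e = \<epsilon> / (CARD('k) + 1)"
  have "e > 0" using assms by (simp add: e_def)
  have "continuous (at 1) Arg" by (rule continuous_at_Arg) simp
  then obtain \<delta> where \<delta>: "\<delta> > 0" "\<And>x. dist x 1 < \<delta> \<Longrightarrow> \<bar>Arg x\<bar> < 2 * pi * e"
    unfolding continuous_at_eps_delta using \<open>e > 0\<close> by (metis Arg_1 diff_zero dist_real_def mult_pos_pos pi_gt_zero zero_less_numeral)
  have "\<exists>w. torus_cover w = z \<and> dist v w < \<epsilon>"
    if z: "z \<in> topspace torus" "dist (torus_cover v) z < \<delta>" for v :: "real^'k" and z
  proof -
    define w :: "real^'k" where "w = (\<chi> i. v $ i + Arg (z $ i / cis (2 * pi * v $ i)) / (2 * pi))"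
    have nz: "norm (z $ i) = 1" for i using z(1) by (auto simp: torus_def)
    have "cis (2 * pi * w $ i) = z $ i" for i
    proof -
      have "cis (2 * pi * w $ i) = cis (2 * pi * v $ i) * cis (Arg (z $ i / cis (2 * pi * v $ i)))"
        by (simp add: w_def cis_mult algebra_simps)
      also have "cis (Arg (z $ i / cis (2 * pi * v $ i))) = z $ i / cis (2 * pi * v $ i)"
        using nz[of i] by (subst cis_Arg) (auto simp: sgn_eq norm_divide)
      finally show ?thesis by simp
    qed
    then have "torus_cover w = z" by (simp add: vec_eq_iff torus_cover_nth)
    have "\<bar>v $ i - w $ i\<bar> \<le> e" for i
    proof -
      have "dist (z $ i / cis (2 * pi * v $ i)) 1 = norm (z $ i - cis (2 * pi * v $ i))"
      proof -
        have "z $ i / cis (2 * pi * v $ i) - 1 = (z $ i - cis (2 * pi * v $ i)) / cis (2 * pi * v $ i)"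
          by (simp add: diff_divide_distrib)
        then show ?thesis by (simp add: dist_norm norm_divide)
      qed
      also have "\<dots> \<le> norm (z - torus_cover v)"
        using Finite_Cartesian_Product.norm_nth_le[of "z - torus_cover v" i] by (simp add: torus_cover_nth)
      finally have "\<bar>Arg (z $ i / cis (2 * pi * v $ i))\<bar> < 2 * pi * e"
        using z(2) \<delta>(2) by (simp add: dist_norm norm_minus_commute)
      then show ?thesis by (simp add: w_def field_simps)
    qed
    then have "norm (v - w) \<le> CARD('k) * e"
      using norm_le_l1_cart[of "v - w"] sum_bounded_above[of UNIV "\<lambda>i. \<bar>(v - w) $ i\<bar>" e] by simp
    moreover have "CARD('k) * e + e = \<epsilon>"
    proof -
      have "CARD('k) * e + e = e * (CARD('k) + 1)" by (simp add: algebra_simps)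
      then show ?thesis unfolding e_def by simp
    qed
    ultimately have "dist v w < \<epsilon>" using \<open>e > 0\<close> by (simp add: dist_norm)
    then show ?thesis using \<open>torus_cover w = z\<close> by blast
  qed
  then show ?thesis using \<delta>(1) by blast
qed

text \<open>Two points of a fibre that lie over different points of \<open>H x\<close> are separated because the
  covering map is Lipschitz; two that lie over the same point differ by a nonzero integer vector.\<close>

lemma torus_cover_preimages_uniform:
  fixes H :: "'x::metric_space \<Rightarrow> (complex^'k::finite) set"
  assumes H: "continuous_map (top_of_set K) (unordered_config n torus) H" and K: "compact K"
  shows "\<exists>\<eta>>0. separated_over \<eta> K (\<lambda>x. torus_cover -` H x)"
    and "uniformly_lower_hemicontinuous_on K (\<lambda>x. torus_cover -` H x)"
proof -
  note H' = H[unfolded torus_def]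
  obtain \<eta> where \<eta>: "\<eta> > 0" "separated_over \<eta> K H" using config_map_uniform(1)[OF H' K] by blast
  let ?\<eta> = "min 1 (\<eta> / (2 * pi))"
  have "separated_over ?\<eta> K (\<lambda>x. torus_cover -` H x)"
    unfolding separated_over_def
  proof (intro ballI impI)
    fix x and v w :: "real^'k"
    assume x: "x \<in> K" and v: "v \<in> torus_cover -` H x" "w \<in> torus_cover -` H x" and d: "dist v w < ?\<eta>"
    have "dist (torus_cover v) (torus_cover w) < \<eta>"
      using torus_cover_lipschitz[of v w] d by (simp add: field_simps)
    then have "torus_cover v = torus_cover w"
      using \<eta>(2) x v by (auto simp: separated_over_def)
    then have *: "v $ i - w $ i \<in> \<int>" for i by (simp add: torus_cover_eq_iff)
    have "\<bar>v $ i - w $ i\<bar> < 1" for i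
      using component_le_norm_cart[of "v - w" i] d by (simp add: dist_norm)
    then have "v $ i = w $ i" for i using Ints_nonzero_abs_less1[OF *] by simp
    then show "v = w" by (simp add: vec_eq_iff)
  qed
  moreover have "?\<eta> > 0" using \<eta>(1) by simp
  ultimately show "\<exists>\<eta>>0. separated_over \<eta> K (\<lambda>x. torus_cover -` H x)" by blast
  have sub: "H x \<subseteq> topspace torus" if "x \<in> K" for x
    using continuous_map_image_subset_topspace[OF H] that by (auto simp: topspace_unordered_config)
  show "uniformly_lower_hemicontinuous_on K (\<lambda>x. torus_cover -` H x)"
    unfolding uniformly_lower_hemicontinuous_on_def
  proof (intro allI impI)
    fix \<epsilon> :: real assume "\<epsilon> > 0"
    obtain \<epsilon>' where \<epsilon>': "\<epsilon>' > 0" "\<And>(v :: real^'k) z. \<lbrakk>z \<in> topspace torus; dist (torus_cover v) z < \<epsilon>'\<rbrakk> \<Longrightarrow>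
        \<exists>w. torus_cover w = z \<and> dist v w < \<epsilon>"
      using torus_cover_uniformly_open[OF \<open>\<epsilon> > 0\<close>] by blast
    obtain \<delta> where \<delta>: "\<delta> > 0" "\<And>x y z. \<lbrakk>x \<in> K; y \<in> K; dist x y < \<delta>; z \<in> H x\<rbrakk> \<Longrightarrow>
        \<exists>w\<in>H y. dist z w < \<epsilon>'"
      using config_map_uniform(2)[OF H' K] \<epsilon>'(1) unfolding uniformly_lower_hemicontinuous_on_def by metis
    have "\<exists>w\<in>torus_cover -` H y. dist v w < \<epsilon>"
      if xy: "x \<in> K" "y \<in> K" "dist x y < \<delta>" and v: "v \<in> torus_cover -` H x" for x y and v :: "real^'k"
    proof -
      obtain z where "z \<in> H y" "dist (torus_cover v) z < \<epsilon>'" using \<delta>(2)[OF xy] v by blast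
      with \<epsilon>'(2)[of z v] sub[OF xy(2)] show ?thesis by auto
    qed
    then show "\<exists>\<delta>>0. \<forall>x\<in>K. \<forall>y\<in>K. dist x y < \<delta> \<longrightarrow>
        (\<forall>v\<in>torus_cover -` H x. \<exists>w\<in>torus_cover -` H y. dist v w < \<epsilon>)"
      using \<delta>(1) by blast
  qed
qed

lemma compact_topspace_torus: "compact (topspace (torus :: (complex^'k::finite) topology))"
proof -
  have "topspace torus = (\<Inter>i. {z :: complex^'k. norm (z $ i) = 1})" by (auto simp: torus_def)
  moreover have "closed {z :: complex^'k. norm (z $ i) = 1}" for i
    by (intro closed_Collect_eq continuous_intros)
  moreover have "norm z \<le> norm (1 :: real^'k)" if "z \<in> topspace torus" for z :: "complex^'k"
    using that unfolding norm_vec_def by (intro L2_set_mono) (auto simp: torus_def)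
  ultimately show ?thesis
    unfolding compact_eq_bounded_closed by (metis (no_types, lifting) boundedI closed_INT)
qed


section \<open>A tube around zero cannot be moved off zero\<close>

text \<open>\<open>U\<close> is the infinite tube \<open>S\<^sup>1 \<times> \<real>\<^sup>k\<^sup>-\<^sup>2\<close>, which \<open>D\<close> moves by a bounded amount and finally squeezes onto
  a translate of its axis. Running the homotopy along the radius fills in the tube: \<open>F\<close> is the
  identity outside it, \<open>D\<close> at time \<open>2 - 2 * r\<close> at radius \<open>r\<close> between \<open>1/2\<close> and \<open>1\<close>, and the squeezed
  map inside radius \<open>1/2\<close>. As \<open>F\<close> has bounded distance from the identity, Brouwer's theorem
  for \<open>\<lambda>x. x - F x\<close> on a large ball gives a zero of \<open>F\<close>, which has norm at most \<open>1\<close> in the \<open>(i, j)\<close>-plane and so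
  comes from a zero of \<open>D\<close>.\<close>

lemma tube_homotopy_has_zero:
  fixes D :: "real \<times> (real^'k::finite) \<Rightarrow> real^'k" and i j :: 'k
  defines "U \<equiv> {u :: real^'k. (u $ i)\<^sup>2 + (u $ j)\<^sup>2 = 1}"
  defines "P \<equiv> \<lambda>x :: real^'k. \<chi> l. if l = i \<or> l = j then 0 else x $ l"
  assumes "i \<noteq> j" and contD: "continuous_on ({0..1} \<times> U) D"
    and D0: "\<And>u. u \<in> U \<Longrightarrow> D (0, u) = u"
    and D1: "\<And>u. u \<in> U \<Longrightarrow> D (1, u) = P u + b"
    and bd: "\<And>t u. \<lbrakk>t \<in> {0..1}; u \<in> U\<rbrakk> \<Longrightarrow> dist (D (t, u)) u \<le> M"
  shows "\<exists>t\<in>{0..1}. \<exists>u\<in>U. D (t, u) = 0"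
proof (rule ccontr)
  assume "\<not> ?thesis"
  then have nz: "\<And>t u. \<lbrakk>t \<in> {0..1}; u \<in> U\<rbrakk> \<Longrightarrow> D (t, u) \<noteq> 0" by blast
  define r where "r = (\<lambda>x :: real^'k. sqrt ((x $ i)\<^sup>2 + (x $ j)\<^sup>2))"
  define \<nu> where "\<nu> = (\<lambda>x :: real^'k. \<chi> l. if l = i \<or> l = j then x $ l / r x else x $ l)"
  have r0: "r x \<ge> 0" for x by (simp add: r_def)
  have comp_le: "\<bar>x $ i\<bar> \<le> r x" "\<bar>x $ j\<bar> \<le> r x" for x
    by (auto simp: r_def intro!: real_le_rsqrt)
  have \<nu>U: "\<nu> x \<in> U" if "r x > 0" for x
  proof -
    have "(x $ i)\<^sup>2 + (x $ j)\<^sup>2 = (r x)\<^sup>2" by (simp add: r_def)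
    then have "(x $ i / r x)\<^sup>2 + (x $ j / r x)\<^sup>2 = 1"
      using that by (metis add_divide_distrib divide_self less_irrefl power_divide power_eq_0_iff)
    then show ?thesis by (simp add: U_def \<nu>_def)
  qed
  have P\<nu>: "P (\<nu> x) = P x" for x by (simp add: P_def \<nu>_def vec_eq_iff)
  have r1: "\<nu> x = x" if "r x = 1" for x using that by (simp add: \<nu>_def vec_eq_iff)
  define F where "F = (\<lambda>x. if r x \<le> 1/2 then P x + b else if r x \<le> 1 then D (2 - 2 * r x, \<nu> x) else x)"
  have contr: "continuous_on A r" for A unfolding r_def by (intro continuous_intros)
  have cont\<nu>: "continuous_on {x. 1/2 \<le> r x} \<nu>"
    unfolding \<nu>_def
  proof (rule continuous_on_vec_lambda)
    fix l
    show "continuous_on {x. 1/2 \<le> r x} (\<lambda>x. if l = i \<or> l = j then x $ l / r x else x $ l)"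
      by (cases "l = i \<or> l = j") (auto intro!: continuous_intros contr)
  qed
  have contP: "continuous_on A P" for A
    unfolding P_def
  proof (rule continuous_on_vec_lambda)
    fix l
    show "continuous_on A (\<lambda>x. if l = i \<or> l = j then 0 else x $ l)"
      by (cases "l = i \<or> l = j") (auto intro!: continuous_intros)
  qed
  have contF: "continuous_on UNIV F"
  proof -
    have inner: "continuous_on {x. 1/2 \<le> r x} (\<lambda>x. if r x \<le> 1 then D (2 - 2 * r x, \<nu> x) else x)"
    proof (rule continuous_on_cases_le[where h = r and a = 1])
      show "continuous_on {x \<in> {x. 1/2 \<le> r x}. r x \<le> 1} (\<lambda>x. D (2 - 2 * r x, \<nu> x))"
        by (rule continuous_on_compose2[OF contD])
          (use \<nu>U in \<open>auto intro!: continuous_intros contr continuous_on_subset[OF cont\<nu>]\<close>)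
      show "D (2 - 2 * r x, \<nu> x) = x" if "x \<in> {x. 1/2 \<le> r x}" "r x = 1" for x
        using that \<nu>U[of x] D0 r1 by simp
    qed (auto intro!: contr continuous_intros)
    show ?thesis unfolding F_def
    proof (rule continuous_on_cases_le[where h = r and a = "1/2"])
      show "continuous_on {x \<in> UNIV. r x \<le> 1/2} (\<lambda>x. P x + b)" by (intro continuous_intros contP)
      show "continuous_on {x \<in> UNIV. 1/2 \<le> r x} (\<lambda>x. if r x \<le> 1 then D (2 - 2 * r x, \<nu> x) else x)"
        using inner by simp
      show "P x + b = (if r x \<le> 1 then D (2 - 2 * r x, \<nu> x) else x)"
        if "x \<in> UNIV" "r x = 1/2" for x
      proof -
        have "2 - 2 * r x = 1" using that by simp
        then show ?thesis using that \<nu>U[of x] D1[of "\<nu> x"] P\<nu>[of x] by (simp only:) simp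
      qed
    qed (rule contr)
  qed
  have near: "norm (x - y) \<le> 4" if "P x = P y" "r x \<le> 1" "r y \<le> 1" for x y
  proof -
    have "norm (x - y) \<le> (\<Sum>l\<in>UNIV. \<bar>(x - y) $ l\<bar>)" by (rule norm_le_l1_cart)
    also have "\<dots> = (\<Sum>l\<in>{i, j}. \<bar>(x - y) $ l\<bar>)"
    proof (rule sum.mono_neutral_right)
      show "\<forall>l\<in>UNIV - {i, j}. \<bar>(x - y) $ l\<bar> = 0"
      proof
        fix l assume "l \<in> UNIV - {i, j}"
        then have "x $ l = P x $ l" "y $ l = P y $ l" by (auto simp: P_def)
        with that(1) show "\<bar>(x - y) $ l\<bar> = 0" by simp
      qed
    qed auto
    also have "\<dots> \<le> 4"
      using \<open>i \<noteq> j\<close> comp_le[of x] comp_le[of y] that by simp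
    finally show ?thesis .
  qed
  have bdF: "norm (x - F x) \<le> M + 4" for x
  proof -
    \<comment> \<open>A point of the tube on the same level as \<open>x\<close>; its direction in the \<open>(i, j)\<close>-plane is arbitrary.\<close>
    define e :: "real^'k" where "e = (\<chi> l. if l = i then 1 else if l = j then 0 else x $ l)"
    have e: "e \<in> U" "P e = P x" "r e \<le> 1"
      using \<open>i \<noteq> j\<close> by (auto simp: e_def U_def P_def r_def vec_eq_iff)
    have "M \<ge> 0" using bd[of 0 e] e order_trans[OF zero_le_dist] by force
    have tri: "norm (x - D (t, u)) \<le> M + 4"
      if "t \<in> {0..1}" "u \<in> U" "P u = P x" "r u \<le> 1" "r x \<le> 1" for t u
      using bd[OF that(1,2)] near[of x u] that norm_triangle_ineq[of "x - u" "u - D (t, u)"]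
      by (simp add: dist_norm norm_minus_commute)
    consider "r x \<le> 1/2" | "1/2 < r x" "r x \<le> 1" | "1 < r x" by linarith
    then show ?thesis
    proof cases
      case 1
      then show ?thesis using tri[of 1 e] D1[of e] e by (simp add: F_def)
    next
      case 2
      then have "\<nu> x \<in> U" using \<nu>U by simp
      moreover from this have "r (\<nu> x) \<le> 1" by (simp add: U_def r_def)
      ultimately show ?thesis using 2 tri[of "2 - 2 * r x" "\<nu> x"] P\<nu> by (simp add: F_def)
    next
      case 3
      then show ?thesis using \<open>M \<ge> 0\<close> by (simp add: F_def)
    qed
  qed
  have "M + 4 \<ge> 0" using order_trans[OF norm_ge_zero bdF] .
  obtain x where "x \<in> cball 0 (M + 4)" "x - F x = x"
    by (rule brouwer[of "cball (0 :: real^'k) (M + 4)" "\<lambda>x. x - F x"])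
      (use bdF \<open>M + 4 \<ge> 0\<close> in \<open>auto intro!: continuous_intros continuous_on_subset[OF contF]\<close>)
  then have F0: "F x = 0" by simp
  define e :: "real^'k" where "e = (\<chi> l. if l = i then 1 else if l = j then 0 else x $ l)"
  have e: "e \<in> U" "P e = P x"
    using \<open>i \<noteq> j\<close> by (auto simp: e_def U_def P_def vec_eq_iff)
  consider "r x \<le> 1/2" | "1/2 < r x" "r x \<le> 1" | "1 < r x" by linarith
  then show False
  proof cases
    case 1
    then show False using F0 nz[of 1 e] D1[of e] e by (simp add: F_def)
  next
    case 2
    then show False using F0 nz[of "2 - 2 * r x" "\<nu> x"] \<nu>U[of x] by (simp add: F_def)
  next
    case 3
    then have "x = 0" using F0 by (simp add: F_def)
    with 3 show False by (simp add: r_def)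
  qed
qed


section \<open>The tube map is not homotopic to an affine map\<close>

text \<open>Over \<open>\<real>\<^sup>k\<close> this is the map that replaces the coordinates \<open>i\<close> and \<open>j\<close> of \<open>t\<close> by
  \<open>e * cos (2 * pi * t $ i)\<close> and \<open>e * sin (2 * pi * t $ i)\<close>: its image is a thin tube
  around a \<open>(k-2)\<close>-dimensional subtorus through the neutral element.\<close>

definition tube_map :: "'k \<Rightarrow> 'k \<Rightarrow> real \<Rightarrow> complex^'k \<Rightarrow> complex^'k" where
  "tube_map i j e z = (\<chi> l. if l = i then cis (2 * pi * (e * Re (z $ i)))
                            else if l = j then cis (2 * pi * (e * Im (z $ i))) else z $ l)"

text \<open>The constant values are spaced by \<open>1/n\<close> along the circle of coordinate \<open>i\<close>, starting at the
  neutral element for \<open>m = 1\<close>. The radius \<open>1/(2n)\<close> keeps all of them off the tube.\<close>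

definition tube_value :: "nat \<Rightarrow> 'k \<Rightarrow> 'k \<Rightarrow> nat \<Rightarrow> complex^'k \<Rightarrow> complex^'k" where
  "tube_value n i j m z =
     (if m = 0 then tube_map i j (1 / (2 * n)) z
      else torus_cover (\<chi> l. if l = i then real (m - 1) / n else 0))"

lemma tube_value_n_valued:
  fixes i j :: "'k::finite"
  assumes "i \<noteq> j"
  shows "n_valued_map n (\<lambda>z. (\<lambda>m. tube_value n i j m z) ` {..<n})"
proof (cases "n = 0")
  case True
  then show ?thesis
    by (simp add: n_valued_map_def continuous_map_const topspace_unordered_config)
next
  case False
  let ?e = "1 / (2 * real n)"
  let ?F = "\<lambda>z. \<lambda>m\<in>{..<n}. tube_value n i j m z"
  have e: "0 < ?e" "?e < 1" using False by auto
  have cont: "continuous_map torus torus (tube_value n i j m)" for m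
  proof (cases "m = 0")
    case True
    have "continuous_on {z :: complex^'k. \<forall>i. z $ i \<in> sphere 0 1} (tube_map i j ?e)"
      unfolding tube_map_def
    proof (rule continuous_on_vec_lambda)
      fix l
      show "continuous_on {z :: complex^'k. \<forall>i. z $ i \<in> sphere 0 1}
         (\<lambda>z. if l = i then cis (2 * pi * (?e * Re (z $ i)))
              else if l = j then cis (2 * pi * (?e * Im (z $ i))) else z $ l)"
        using \<open>n \<noteq> 0\<close> by (cases "l = i"; cases "l = j") (auto intro!: continuous_intros)
    qed
    moreover have "tube_value n i j m = tube_map i j ?e" using True by (simp add: tube_value_def fun_eq_iff)
    ultimately show ?thesis
      by (auto simp: torus_def tube_map_def)
  next
    case False
    then show ?thesis
      by (auto simp: tube_value_def torus_def continuous_map_const torus_cover_nth)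
  qed
  have apart0: "tube_value n i j 0 z \<noteq> tube_value n i j m z"
    if z: "z \<in> topspace torus" and m: "0 < m" "m < n" for z m
  proof
    assume eq: "tube_value n i j 0 z = tube_value n i j m z"
    \<comment> \<open>Coordinate \<open>j\<close> forces \<open>Im (z $ i) = 0\<close>; then coordinate \<open>i\<close> makes the odd number \<open>1\<close> even.\<close>
    have nz: "(Re (z $ i))\<^sup>2 + (Im (z $ i))\<^sup>2 = 1"
      using z by (auto simp: torus_def cmod_def)
    have "cis (2 * pi * (?e * Im (z $ i))) = cis (2 * pi * 0)"
      using arg_cong[OF eq, of "\<lambda>v. v $ j"] m \<open>i \<noteq> j\<close>
      by (simp add: tube_value_def tube_map_def torus_cover_nth)
    then have "?e * Im (z $ i) \<in> \<int>" by (subst (asm) cis_eq_iff_Ints) simp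
    moreover have "\<bar>?e * Im (z $ i)\<bar> < 1"
    proof -
      have "\<bar>Im (z $ i)\<bar> \<le> 1" using abs_Im_le_cmod[of "z $ i"] z by (simp add: torus_def)
      moreover have "1 < 2 * real n" using \<open>n \<noteq> 0\<close> by simp
      ultimately have "\<bar>Im (z $ i)\<bar> < 2 * real n" by linarith
      then show ?thesis using \<open>n \<noteq> 0\<close> by (simp add: abs_mult)
    qed
    ultimately have "?e * Im (z $ i) = 0" using Ints_nonzero_abs_less1 by blast
    then have "Im (z $ i) = 0" using e by simp
    with nz have Re: "\<bar>Re (z $ i)\<bar> = 1" by (auto simp: power2_eq_1_iff)
    have "cis (2 * pi * (?e * Re (z $ i))) = cis (2 * pi * (real (m - 1) / n))"
      using arg_cong[OF eq, of "\<lambda>v. v $ i"] m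
      by (simp add: tube_value_def tube_map_def torus_cover_nth)
    then have "?e * Re (z $ i) - real (m - 1) / n \<in> \<int>" by (subst (asm) cis_eq_iff_Ints)
    moreover have "?e * Re (z $ i) - real (m - 1) / n = (Re (z $ i) - 2 * real (m - 1)) / (2 * n)"
      using False by (simp add: field_simps)
    moreover have "\<bar>Re (z $ i) - 2 * real (m - 1)\<bar> < 2 * n"
      using Re m by (simp add: of_nat_diff)
    ultimately have "Re (z $ i) = 2 * real (m - 1)"
      using Ints_nonzero_abs_less1[of "(Re (z $ i) - 2 * real (m - 1)) / (2 * n)"] False
      by (simp add: field_simps)
    with Re have "\<bar>2 * real (m - 1)\<bar> = 1" by (simp only:)
    then have "real (2 * (m - 1)) = real 1"
      by (simp only: abs_mult abs_of_nat abs_numeral of_nat_mult of_nat_numeral of_nat_1)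
    then have "2 * (m - 1) = 1" by (simp only: of_nat_eq_iff)
    then show False by presburger
  qed
  have apart: "tube_value n i j m z \<noteq> tube_value n i j m' z" if m: "0 < m" "m < m'" "m' < n" for z m m'
  proof
    assume eq: "tube_value n i j m z = tube_value n i j m' z"
    have "cis (2 * pi * (real (m' - 1) / n)) = cis (2 * pi * (real (m - 1) / n))"
      using arg_cong[OF eq, of "\<lambda>v. v $ i"] m by (simp add: tube_value_def torus_cover_nth)
    then have "real (m' - 1) / n - real (m - 1) / n \<in> \<int>" by (subst (asm) cis_eq_iff_Ints)
    moreover have "real (m' - 1) / n - real (m - 1) / n = (real m' - real m) / n"
      using m by (simp add: of_nat_diff diff_divide_distrib)
    moreover have "0 < (real m' - real m) / n" "(real m' - real m) / n < 1" using m by auto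
    ultimately show False by (metis Ints_nonzero_abs_less1 abs_of_pos less_irrefl)
  qed
  have inj: "inj_on (?F z) {..<n}" if "z \<in> topspace torus" for z
  proof (rule linorder_inj_onI)
    fix m m' assume "m < m'" "m \<in> {..<n}" "m' \<in> {..<n}"
    then show "?F z m \<noteq> ?F z m'"
      using apart0[OF that, of m'] apart[of m m' z] by (cases "m = 0") auto
  qed auto
  have "continuous_map torus (ordered_config n torus) ?F"
    unfolding ordered_config_def continuous_map_in_subtopology continuous_map_componentwise
    using cont inj by auto
  then have "continuous_map torus (unordered_config n torus) ((\<lambda>x. x ` {..<n}) \<circ> ?F)"
    by (rule continuous_map_compose)
      (rule quotient_imp_continuous_map[OF quotient_map_unordered_config])
  moreover have "(\<lambda>x. x ` {..<n}) \<circ> ?F = (\<lambda>z. (\<lambda>m. tube_value n i j m z) ` {..<n})"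
    by (auto simp: fun_eq_iff)
  ultimately show ?thesis by (simp add: n_valued_map_def)
qed

text \<open>At \<open>x0\<close> the section lies on one of the affine branches, up to an integer vector; by uniqueness
  of sections it stays on that translated branch.\<close>

lemma affine_section:
  fixes \<pi> s :: "'x::topological_space \<Rightarrow> real^'k::finite"
  assumes conn: "connected X" and "x0 \<in> X" and "\<eta> > 0"
    and sep: "separated_over \<eta> X (\<lambda>x. torus_cover -` g (torus_cover (\<pi> x)))"
    and aff: "\<And>t. g (torus_cover t) = (\<lambda>m. torus_cover (A m *v t + a m)) ` N"
    and cont: "continuous_on X \<pi>" "continuous_on X s"
    and s: "\<And>x. x \<in> X \<Longrightarrow> torus_cover (s x) \<in> g (torus_cover (\<pi> x))"
  obtains B b where "\<And>x. x \<in> X \<Longrightarrow> s x = B *v \<pi> x + b"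
proof -
  obtain m where m: "m \<in> N" "torus_cover (s x0) = torus_cover (A m *v \<pi> x0 + a m)"
    using s[OF \<open>x0 \<in> X\<close>] aff by auto
  define b where "b = s x0 - A m *v \<pi> x0"
  have shift: "torus_cover (A m *v t + b) = torus_cover (A m *v t + a m)" for t
    using m(2) by (auto simp: torus_cover_eq_iff b_def algebra_simps)
  have "s x = A m *v \<pi> x + b" if "x \<in> X" for x
  proof (rule sections_agree[OF conn \<open>\<eta> > 0\<close> sep cont(2) _ _ _ \<open>x0 \<in> X\<close> _ that])
    show "continuous_on X (\<lambda>x. A m *v \<pi> x + b)"
      by (intro continuous_intros cont(1) matrix_vector_mult_linear_continuous_on
            continuous_on_compose2[OF matrix_vector_mult_linear_continuous_on cont(1)]) auto
    show "A m *v \<pi> x + b \<in> torus_cover -` g (torus_cover (\<pi> x))" for x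
      using m(1) by (auto simp: shift aff)
  qed (use s in \<open>auto simp: b_def\<close>)
  then show thesis by (rule that)
qed

lemma bounded_linear_imp_zero:
  fixes L :: "'a::real_vector \<Rightarrow> 'b::real_normed_vector"
  assumes "linear L" and bd: "\<And>x. norm (L x) \<le> M"
  shows "L x = 0"
proof (rule ccontr)
  assume "L x \<noteq> 0"
  then obtain N :: nat where "M < real N * norm (L x)"
    using reals_Archimedean3[of "norm (L x)"] by auto
  moreover have "norm (L (real N *\<^sub>R x)) = real N * norm (L x)"
    by (simp add: linear_scale[OF \<open>linear L\<close>])
  ultimately show False using bd[of "real N *\<^sub>R x"] by simp
qed

lemma torus_eq: "torus = top_of_set (topspace torus)"
  by (simp add: torus_def)

text \<open>Lift the tube and the neutral element through the homotopy, and let \<open>D\<close> be the difference of the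
  two lifts, rescaled to radius \<open>1\<close>. It has no zero, since the two lifts cannot meet. At the end of the
  homotopy both lifts are affine along the winding parametrisation of the tube, so \<open>D\<close> is affine too; being at
  bounded distance from the tube, it has the linear part of the projection onto the axis. This
  contradicts the lemma on tubes.\<close>

lemma tube_not_homotopic_affine:
  fixes i j :: "'k::finite"
  assumes "i \<noteq> j" "n \<ge> 2" and g: "affine_n_valued_map n g"
  shows "\<not> homotopic_with (\<lambda>_. True) torus (unordered_config n torus)
           (\<lambda>z. (\<lambda>m. tube_value n i j m z) ` {..<n}) g"
proof
  assume "homotopic_with (\<lambda>_. True) torus (unordered_config n torus)
           (\<lambda>z. (\<lambda>m. tube_value n i j m z) ` {..<n}) g"
  then obtain H where contH: "continuous_map (prod_topology (top_of_set {0..1::real}) torus)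
        (unordered_config n torus) H"
    and H0: "\<And>z. H (0, z) = (\<lambda>m. tube_value n i j m z) ` {..<n}" and H1: "\<And>z. H (1, z) = g z"
    unfolding homotopic_with_def by blast
  obtain A a where aff: "\<And>t. g (torus_cover t) = (\<lambda>m. torus_cover (A m *v t + a m)) ` {..<n}"
    using g unfolding affine_n_valued_map_def by blast
  define e where "e = 1 / (2 * real n)"
  have "e > 0" using \<open>n \<ge> 2\<close> by (simp add: e_def)
  define T where "T = topspace (torus :: (complex^'k) topology)"
  define G where "G = (\<lambda>x. torus_cover -` H x)"
  have "prod_topology (top_of_set {0..1::real}) torus = top_of_set ({0..1} \<times> T)"
    unfolding T_def by (subst torus_eq) (rule prod_topology_subtopology_eu)
  then have contH': "continuous_map (top_of_set ({0..1} \<times> T)) (unordered_config n torus) H"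
    using contH by simp
  have "compact ({0..1::real} \<times> T)"
    unfolding T_def by (intro compact_Times compact_topspace_torus compact_Icc)
  from torus_cover_preimages_uniform[OF contH' this]
  obtain \<eta> where "\<eta> > 0" and sep: "separated_over \<eta> ({0..1} \<times> T) G"
    and unif: "uniformly_lower_hemicontinuous_on ({0..1} \<times> T) G"
    unfolding G_def by blast
  \<comment> \<open>The homotopy is pulled back to the tube \<open>U\<close> and not to \<open>\<real>\<^sup>k\<close>, so that the lifts are by construction periodic
      in the angle around the tube.\<close>
  define U where "U = {u :: real^'k. (u $ i)\<^sup>2 + (u $ j)\<^sup>2 = 1}"
  define q :: "real^'k \<Rightarrow> complex^'k" where
    "q = (\<lambda>u. \<chi> l. if l = i then Complex (u $ i) (u $ j) else if l = j then 1 else cis (2 * pi * u $ l))"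
  define \<phi> :: "real^'k \<Rightarrow> real^'k" where "\<phi> = (\<lambda>u. \<chi> l. if l = i \<or> l = j then e * u $ l else u $ l)"
  have contq: "continuous_on U q"
    unfolding q_def
  proof (rule continuous_on_vec_lambda)
    fix l
    show "continuous_on U (\<lambda>u. if l = i then Complex (u $ i) (u $ j)
        else if l = j then 1 else cis (2 * pi * u $ l))"
      by (cases "l = i"; cases "l = j") (auto intro!: continuous_intros simp: Complex_eq)
  qed
  have qU: "q ` U \<subseteq> T"
    by (auto simp: q_def U_def T_def torus_def cmod_def)
  have cont\<phi>: "continuous_on U \<phi>"
    unfolding \<phi>_def
  proof (rule continuous_on_vec_lambda)
    fix l
    show "continuous_on U (\<lambda>u. if l = i \<or> l = j then e * u $ l else u $ l)"
      by (cases "l = i \<or> l = j") (auto intro!: continuous_intros)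
  qed
  have "torus_cover (\<phi> u) = tube_value n i j 0 (q u)" for u
    using \<open>i \<noteq> j\<close> by (simp add: vec_eq_iff torus_cover_nth \<phi>_def q_def tube_value_def tube_map_def e_def)
  then have \<phi>G: "\<phi> u \<in> G (0, q u)" for u
    using \<open>n \<ge> 2\<close> by (auto simp: G_def H0)
  have "torus_cover 0 = tube_value n i j 1 z" for z
    by (simp add: vec_eq_iff torus_cover_nth tube_value_def)
  then have zeroG: "0 \<in> G (0, z)" for z
    using \<open>n \<ge> 2\<close> by (auto simp: G_def H0 intro!: image_eqI[of _ _ 1])
  obtain h M where h: "continuous_on ({0..1} \<times> U) h" "\<And>u. u \<in> U \<Longrightarrow> h (0, u) = \<phi> u"
    "\<And>t u. \<lbrakk>t \<in> {0..1}; u \<in> U\<rbrakk> \<Longrightarrow> h (t, u) \<in> G (t, q u)"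
    "\<And>t u. \<lbrakk>t \<in> {0..1}; u \<in> U\<rbrakk> \<Longrightarrow> dist (h (t, u)) (\<phi> u) \<le> M"
    by (rule homotopy_section_lift[OF \<open>\<eta> > 0\<close> sep unif contq qU cont\<phi>, OF \<phi>G]) blast
  obtain k M' where k: "continuous_on ({0..1} \<times> U) k" "\<And>u. u \<in> U \<Longrightarrow> k (0, u) = 0"
    "\<And>t u. \<lbrakk>t \<in> {0..1}; u \<in> U\<rbrakk> \<Longrightarrow> k (t, u) \<in> G (t, q u)"
    "\<And>t u. \<lbrakk>t \<in> {0..1}; u \<in> U\<rbrakk> \<Longrightarrow> dist (k (t, u)) 0 \<le> M'"
    by (rule homotopy_section_lift[OF \<open>\<eta> > 0\<close> sep unif contq qU continuous_on_const, OF zeroG]) blast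
  \<comment> \<open>\<open>\<Lambda>\<close> undoes the scaling of the tube by \<open>e\<close>.\<close>
  define \<Lambda> :: "real^'k \<Rightarrow> real^'k" where "\<Lambda> = (\<lambda>x. \<chi> l. if l = i \<or> l = j then x $ l / e else x $ l)"
  define P :: "real^'k \<Rightarrow> real^'k" where "P = (\<lambda>x. \<chi> l. if l = i \<or> l = j then 0 else x $ l)"
  have lin\<Lambda>: "linear \<Lambda>"
    by (rule linearI) (auto simp: \<Lambda>_def vec_eq_iff add_divide_distrib)
  have \<Lambda>\<phi>: "\<Lambda> (\<phi> u) = u" for u using \<open>e > 0\<close> by (simp add: \<Lambda>_def \<phi>_def vec_eq_iff)
  have \<Lambda>0: "x = 0" if "\<Lambda> x = 0" for x
  proof -
    have "x = \<phi> (\<Lambda> x)" using \<open>e > 0\<close> by (simp add: \<Lambda>_def \<phi>_def vec_eq_iff)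
    with that show ?thesis by (simp add: \<phi>_def vec_eq_iff)
  qed
  define D where "D = (\<lambda>x. \<Lambda> (h x - k x))"
  have contD: "continuous_on ({0..1} \<times> U) D"
    unfolding D_def by (intro linear_continuous_on_compose[OF _ lin\<Lambda>] continuous_intros h(1) k(1))
  have D0: "D (0, u) = u" if "u \<in> U" for u
    using that h(2) k(2) by (simp add: D_def \<Lambda>\<phi>)
  have nz: "D (t, u) \<noteq> 0" if tu: "t \<in> {0..1}" "u \<in> U" for t u
  proof
    assume "D (t, u) = 0"
    then have "h (t, u) - k (t, u) = 0" unfolding D_def by (rule \<Lambda>0)
    then have "h (t, u) = k (t, u)" by simp
    have "h (0, u) = k (0, u)"
    proof (rule sections_agree[where X = "{0..1}" and \<eta> = \<eta> and G = "\<lambda>t. G (t, q u)" and ?x0.0 = t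
          and s = "\<lambda>t. h (t, u)" and s' = "\<lambda>t. k (t, u)"])
      show "separated_over \<eta> {0..1} (\<lambda>t. G (t, q u))"
        using sep qU tu by (auto simp: separated_over_def)
      show "continuous_on {0..1} (\<lambda>t. h (t, u))"
        by (rule continuous_on_compose2[OF h(1)]) (use tu in \<open>auto intro!: continuous_intros\<close>)
      show "continuous_on {0..1} (\<lambda>t. k (t, u))"
        by (rule continuous_on_compose2[OF k(1)]) (use tu in \<open>auto intro!: continuous_intros\<close>)
    qed (use \<open>h (t, u) = k (t, u)\<close> \<open>\<eta> > 0\<close> tu h(3) k(3) in auto)
    then have "D (0, u) = 0" by (simp add: D_def linear_0[OF lin\<Lambda>])
    then show False using D0[OF tu(2)] tu(2) by (simp add: U_def)
  qed
  obtain C where C: "C > 0" "\<And>x. norm (\<Lambda> x) \<le> C * norm x"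
    using linear_bounded_pos[OF lin\<Lambda>] by blast
  have bdD: "dist (D (t, u)) u \<le> C * (M + M')" if tu: "t \<in> {0..1}" "u \<in> U" for t u
  proof -
    have "D (t, u) - u = \<Lambda> ((h (t, u) - \<phi> u) - k (t, u))"
      by (simp add: D_def \<Lambda>\<phi> linear_diff[OF lin\<Lambda>])
    then have "norm (D (t, u) - u) \<le> C * norm ((h (t, u) - \<phi> u) - k (t, u))"
      using C(2) by simp
    also have "\<dots> \<le> C * (M + M')"
      using h(4)[OF tu] k(4)[OF tu] C(1) norm_triangle_ineq4[of "h (t, u) - \<phi> u" "k (t, u)"]
      by (intro mult_left_mono) (auto simp: dist_norm)
    finally show ?thesis by (simp add: dist_norm)
  qed
  \<comment> \<open>Along the winding parametrisation \<open>wrap\<close> of \<open>U\<close> by \<open>\<real>\<^sup>k\<close>, the map \<open>q\<close> becomes the covering map after the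
      linear map \<open>\<pi>\<close>, which makes the affine description of \<open>g\<close> applicable.\<close>
  define \<pi> :: "real^'k \<Rightarrow> real^'k" where "\<pi> = (\<lambda>x. \<chi> l. if l = j then 0 else x $ l)"
  define wrap :: "real^'k \<Rightarrow> real^'k" where
    "wrap = (\<lambda>x. \<chi> l. if l = i then cos (2 * pi * x $ i) else if l = j then sin (2 * pi * x $ i) else x $ l)"
  have wrapU: "wrap x \<in> U" for x using \<open>i \<noteq> j\<close> by (simp add: wrap_def U_def)
  have qwrap: "q (wrap x) = torus_cover (\<pi> x)" for x
    using \<open>i \<noteq> j\<close> by (simp add: q_def wrap_def \<pi>_def vec_eq_iff torus_cover_nth complex_eq_iff)
  have lin\<pi>: "linear \<pi>" by (rule linearI) (auto simp: \<pi>_def vec_eq_iff)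
  have linP: "linear P" by (rule linearI) (auto simp: P_def vec_eq_iff)
  have cont\<pi>: "continuous_on UNIV \<pi>" by (rule linear_continuous_on) (simp add: lin\<pi> linear_conv_bounded_linear[symmetric])
  have contwrap: "continuous_on UNIV wrap"
    unfolding wrap_def
  proof (rule continuous_on_vec_lambda)
    fix l
    show "continuous_on UNIV (\<lambda>x. if l = i then cos (2 * pi * x $ i)
        else if l = j then sin (2 * pi * x $ i) else x $ l)"
      by (cases "l = i"; cases "l = j") (auto intro!: continuous_intros)
  qed
  have sep1: "separated_over \<eta> UNIV (\<lambda>x. torus_cover -` g (torus_cover (\<pi> x)))"
    unfolding separated_over_def
  proof (intro ballI impI)
    fix x v w
    assume "v \<in> torus_cover -` g (torus_cover (\<pi> x))" "w \<in> torus_cover -` g (torus_cover (\<pi> x))" "dist v w < \<eta>"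
    moreover have "(1 :: real, q (wrap x)) \<in> {0..1} \<times> T" using qU wrapU by auto
    ultimately show "v = w" using sep unfolding separated_over_def G_def by (metis H1 qwrap)
  qed
  have end_affine: "\<exists>B b. \<forall>x. s (1, wrap x) = B *v \<pi> x + b"
    if s: "continuous_on ({0..1} \<times> U) s" "\<And>t u. \<lbrakk>t \<in> {0..1}; u \<in> U\<rbrakk> \<Longrightarrow> s (t, u) \<in> G (t, q u)" for s
  proof -
    have "continuous_on UNIV (\<lambda>x. s (1, wrap x))"
      by (rule continuous_on_compose2[OF s(1)])
        (use wrapU in \<open>auto intro!: continuous_intros contwrap\<close>)
    moreover have "torus_cover (s (1, wrap x)) \<in> g (torus_cover (\<pi> x))" for x
      using s(2)[of 1 "wrap x"] wrapU by (simp add: G_def H1 qwrap)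
    ultimately obtain B b where "\<And>x. x \<in> UNIV \<Longrightarrow> s (1, wrap x) = B *v \<pi> x + b"
      using affine_section[OF connected_UNIV UNIV_I \<open>\<eta> > 0\<close> sep1 aff cont\<pi>] by blast
    then show ?thesis by blast
  qed
  obtain B b where B: "\<And>x. h (1, wrap x) = B *v \<pi> x + b" using end_affine[OF h(1,3)] by blast
  obtain B' b' where B': "\<And>x. k (1, wrap x) = B' *v \<pi> x + b'" using end_affine[OF k(1,3)] by blast
  \<comment> \<open>\<open>L\<close> measures how far the linear part of \<open>D\<close> is from the projection; boundedness will kill it.\<close>
  define L where "L = (\<lambda>x. \<Lambda> ((B - B') *v \<pi> x) - P x)"
  have linL: "linear L"
    unfolding L_def
    by (intro linear_compose_sub linP linear_compose[OF lin\<pi>, unfolded o_def]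
          linear_compose[OF matrix_vector_mul_linear lin\<Lambda>, unfolded o_def]
          linear_compose[OF linear_compose[OF lin\<pi> matrix_vector_mul_linear] lin\<Lambda>, unfolded o_def])
  have Dwrap: "D (1, wrap x) = L x + P x + \<Lambda> (b - b')" for x
  proof -
    have "h (1, wrap x) - k (1, wrap x) = (B - B') *v \<pi> x + (b - b')"
      by (simp add: B B' matrix_vector_mult_diff_rdistrib)
    then show ?thesis by (simp add: D_def L_def linear_add[OF lin\<Lambda>])
  qed
  have "L x = 0" for x
  proof (rule bounded_linear_imp_zero[OF linL])
    fix x
    have "wrap x - P x = axis i (cos (2 * pi * x $ i)) + axis j (sin (2 * pi * x $ i))"
      using \<open>i \<noteq> j\<close> by (simp add: vec_eq_iff wrap_def P_def axis_def)
    then have "norm (wrap x - P x) \<le> norm (axis i (cos (2 * pi * x $ i)) :: real^'k)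
        + norm (axis j (sin (2 * pi * x $ i)) :: real^'k)"
      by (metis norm_triangle_ineq)
    also have "\<dots> \<le> 2"
      using abs_cos_le_one[of "2 * pi * x $ i"] abs_sin_le_one[of "2 * pi * x $ i"] by (simp add: norm_eq_sqrt_inner inner_axis_axis del: abs_cos_le_one abs_sin_le_one)
    finally have w: "norm (wrap x - P x) \<le> 2" .
    have "L x = (D (1, wrap x) - wrap x) + (wrap x - P x) - \<Lambda> (b - b')" by (simp add: Dwrap)
    also have "norm \<dots> \<le> norm (D (1, wrap x) - wrap x) + norm (wrap x - P x) + norm (\<Lambda> (b - b'))"
      by (rule order_trans[OF norm_triangle_ineq4 add_right_mono[OF norm_triangle_ineq]])
    finally show "norm (L x) \<le> C * (M + M') + 2 + norm (\<Lambda> (b - b'))"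
      using bdD[of 1 "wrap x"] wrapU w by (simp add: dist_norm)
  qed
  moreover have "P (wrap x) = P x" for x by (simp add: P_def wrap_def vec_eq_iff)
  ultimately have Dwrap': "D (1, wrap x) = P (wrap x) + \<Lambda> (b - b')" for x
    by (simp add: Dwrap)
  have D1: "D (1, u) = P u + \<Lambda> (b - b')" if "u \<in> U" for u
  proof -
    have "(u $ i)\<^sup>2 + (u $ j)\<^sup>2 = 1" using that by (simp add: U_def)
    then obtain \<theta> where \<theta>: "u $ i = cos \<theta>" "u $ j = sin \<theta>" by (rule sincos_total_2pi)
    define x :: "real^'k" where "x = (\<chi> l. if l = i then \<theta> / (2 * pi) else u $ l)"
    have "wrap x = u" using \<theta> by (simp add: wrap_def x_def vec_eq_iff)
    with Dwrap' show ?thesis by metis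
  qed
  have "\<exists>t\<in>{0..1}. \<exists>u\<in>U. D (t, u) = 0"
    unfolding U_def
    by (rule tube_homotopy_has_zero[OF \<open>i \<noteq> j\<close>, where b = "\<Lambda> (b - b')" and M = "C * (M + M')"])
      (use contD D0 D1 bdD in \<open>simp_all add: U_def P_def\<close>)
  with nz show False by blast
qed

theorem mainTheorem1:
  fixes n :: nat
  assumes "n \<ge> 2" and "CARD('k::finite) \<ge> 2"
  shows "\<exists>f :: complex ^ 'k \<Rightarrow> (complex ^ 'k) set. n_valued_map n f \<and>
           (\<forall>g. affine_n_valued_map n g \<longrightarrow>
              \<not> homotopic_with (\<lambda>_. True) torus (unordered_config n torus) f g)"
proof -
  obtain i j :: 'k where "i \<noteq> j"
    using assms(2) card_le_Suc0_iff_eq[of "UNIV :: 'k set"] by fastforce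
  then show ?thesis
    using tube_value_n_valued tube_not_homotopic_affine[OF _ assms(1)] by blast
qed

end
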